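(* Let $A\in\mathbb{R}^{n\times n}$ be nonsingular, $u,v,b\in\mathbb{R}^n$, and suppose that all linear systems with $A$ are solved normwise backward stably with stability constant $c_s$. Let $\widehat x$ be the solution of $(A+uv^T)x=b$ computed by the modified Sherman--Morrison algorithm (MSM) in floating point arithmetic with unit roundoff $\epsilon_M$, and let $\widehat p,\widehat\theta,\widehat\theta_1$ be the computed values of the correction vector $p$ and the scalars $\theta,\theta_1$ in that algorithm. Then the relative backward error $$\omega(\widehat x)=\frac{\|b-(A+uv^T)\widehat x\|}{\|A+uv^T\|\,\|\widehat x\|+\|b\|}$$ satisfies $$\omega(\widehat x)\le\epsilon_M(2n+4+2c_s)\frac{\big(\|A\|+\|u\|\|v\|\big)\big(\|\widehat x\|+\|\widehat p\|\big)}{\|A+uv^T\|\,\|\widehat x\|+\|b\|}+\epsilon_M(1+c_s)\frac{\|u\|\big(|\widehat\theta|+|\widehat\theta_1|\big)+\|b\|}{\|A+uv^T\|\,\|\widehat x\|+\|b\|}+\mathcal O(\epsilon_M^2).$$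
   Context: Norms: $\|\cdot\|$ is the Euclidean vector norm and the induced matrix 2-norm. Algorithm MSM (for $(A+uv^T)x=b$): (1) solve $Ay=b$ for $y$; (2) solve $Az=u$ for $z$; (3) compute $\alpha=v^Ty$, $\beta=1+v^Tz$, $\theta=\alpha/\beta$; (4) compute $d=b-u\theta$; (5) solve $Aw=d$ for $w$; (6) compute $\theta_1=(v^Tw-\theta)/\beta$; (7) compute $p=z\theta_1$; (8) output $x=w-p$. Hats denote the quantities actually computed in floating point arithmetic. The matrix $A+uv^T$ is nonsingular (equivalently, the exact $\beta$ is nonzero), the computed $\widehat\beta$ is nonzero, and the denominator in $\omega(\widehat x)$ is nonzero. Floating point model: $\epsilon_M$ is the unit roundoff, $n\epsilon_M<1$, $\gamma_n=n\epsilon_M/(1-n\epsilon_M)$. Every scalar operation satisfies $\mathrm{fl}(a\circ b)=(a\circ b)(1+\delta)$, $|\delta|\le\epsilon_M$, $\circ\in\{+,-,\times,/\}$ (vector operations being performed entrywise). A computed inner product satisfies $\mathrm{fl}(v^Tw)=v^T(I+D)w$ with $D$ diagonal and $|D|\le\gamma_n I$ entrywise. Normwise backward stable solve with constant $c_s$ (a fixed constant independent of $\epsilon_M$): for a right-hand side $g$ (in step (5) the computed vector $\widehat d$), the computed solution $\widehat s$ of $As=g$ satisfies $(A+\delta A)\widehat s=g+\delta g$ for some $\delta A,\delta g$ (which may differ from solve to solve) with $\|\delta A\|\le c_s\epsilon_M\|A\|$ and $\|\delta g\|\le c_s\epsilon_M\|g\|$. $\mathcal O(\epsilon_M^2)$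 denotes a quantity bounded in absolute value by $C\epsilon_M^2$ for all sufficiently small $\epsilon_M>0$, where $C$ and the smallness threshold may depend on $n,c_s,A,u,v,b$ but not on $\epsilon_M$ or on the particular rounding errors committed. *)

theory Defs
  imports "HOL-Analysis.Analysis"
begin

(* The library's norm on matrices, as elements of real^'n^'n, is the Frobenius norm. *)
definition mat_norm2 :: "real^'n^'m \<Rightarrow> real"
  where "mat_norm2 A = onorm (\<lambda>x. A *v x)"

definition outer_prod :: "real^'m \<Rightarrow> real^'n \<Rightarrow> real^'n^'m"
  where "outer_prod u v = (\<chi> i j. u $ i * v $ j)"

definition backward_error :: "real^'n^'n \<Rightarrow> real^'n \<Rightarrow> real^'n \<Rightarrow> real"
  where "backward_error M b x = norm (b - M *v x) / (mat_norm2 M * norm x + norm b)"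

definition gamma_fl :: "nat \<Rightarrow> real \<Rightarrow> real"
  where "gamma_fl n eps = real n * eps / (1 - real n * eps)"

(* The rounding model only bounds the errors, so the computed quantities are described by
   relations: the last argument is an admissible computed value. *)

definition fl_rounded :: "real \<Rightarrow> real \<Rightarrow> real \<Rightarrow> bool"
  where "fl_rounded eps a c \<longleftrightarrow> (\<exists>\<delta>. \<bar>\<delta>\<bar> \<le> eps \<and> c = a * (1 + \<delta>))"

definition fl_rounded_vec :: "real \<Rightarrow> real^'n \<Rightarrow> real^'n \<Rightarrow> bool"
  where "fl_rounded_vec eps a c \<longleftrightarrow> (\<forall>i. fl_rounded eps (a $ i) (c $ i))"

definition fl_inner :: "real \<Rightarrow> real^'n \<Rightarrow> real^'n \<Rightarrow> real \<Rightarrow> bool"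
  where "fl_inner eps v w c \<longleftrightarrow>
    (\<exists>D :: real^'n^'n.
       (\<forall>i j. \<bar>D $ i $ j\<bar> \<le> (if i = j then gamma_fl CARD('n) eps else 0)) \<and>
       c = v \<bullet> ((mat 1 + D) *v w))"

definition stable_solve ::
    "real \<Rightarrow> real \<Rightarrow> real^'n^'n \<Rightarrow> real^'n \<Rightarrow> real^'n \<Rightarrow> bool"
  where "stable_solve cs eps A g s \<longleftrightarrow>
    (\<exists>(\<delta>A :: real^'n^'n) (\<delta>g :: real^'n).
       (A + \<delta>A) *v s = g + \<delta>g \<and>
       mat_norm2 \<delta>A \<le> cs * eps * mat_norm2 A \<and>
       norm \<delta>g \<le> cs * eps * norm g)"

(* All variables after b are the computed ("hatted") quantities of one floating point run;
   the existentially quantified ones are the rounded intermediate results.  The run is meaningful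
   only when \<beta> is nonzero, since \<theta> and \<theta>1 are quotients by it. *)
definition msm_run ::
    "real \<Rightarrow> real \<Rightarrow> real^'n^'n \<Rightarrow> real^'n \<Rightarrow> real^'n \<Rightarrow> real^'n \<Rightarrow>
     real^'n \<Rightarrow> real^'n \<Rightarrow> real \<Rightarrow> real \<Rightarrow> real \<Rightarrow> real^'n \<Rightarrow> real^'n \<Rightarrow> real \<Rightarrow> real^'n \<Rightarrow> real^'n \<Rightarrow>
     bool"
  where "msm_run cs eps A u v b y z \<alpha> \<beta> \<theta> d w \<theta>1 p x \<longleftrightarrow>
    stable_solve cs eps A b y \<and>
    stable_solve cs eps A u z \<and>
    fl_inner eps v y \<alpha> \<and>
    (\<exists>t. fl_inner eps v z t \<and> fl_rounded eps (1 + t) \<beta>) \<and>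
    fl_rounded eps (\<alpha> / \<beta>) \<theta> \<and>
    (\<exists>q. fl_rounded_vec eps (\<theta> *\<^sub>R u) q \<and> fl_rounded_vec eps (b - q) d) \<and>
    stable_solve cs eps A d w \<and>
    (\<exists>s r. fl_inner eps v w s \<and> fl_rounded eps (s - \<theta>) r \<and> fl_rounded eps (r / \<beta>) \<theta>1) \<and>
    fl_rounded_vec eps (\<theta>1 *\<^sub>R z) p \<and>
    fl_rounded_vec eps (w - p) x"

end

theory Submission
  imports Defs "HOL-Library.Landau_Symbols"
begin

text \<open>
  The residual of the computed \<open>x\<close> splits into the rounding error of \<open>d\<close>, the residual of the solve
  for \<open>w\<close>, the errors of \<open>p\<close> and \<open>x\<close>, and a multiple of \<open>u\<close> coming from \<open>\<theta>1\<close>.  In exact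
  arithmetic \<open>v \<bullet> w = \<theta>\<close>, so the exact \<open>\<theta>1\<close> and \<open>p\<close> vanish and the computed ones are
  \<open>O(eps)\<close>; every rounding error multiplied by them is of second order.  The rounding error of \<open>d\<close>
  exceeds the budget \<open>(1 + cs) * eps * norm u * \<bar>\<theta>\<bar>\<close> by one copy of \<open>eps * norm u * \<bar>\<theta>\<bar>\<close>, which
  is absorbed into the first term through \<open>\<bar>\<theta>\<bar> \<le> norm v * norm x + O(eps)\<close>.  The second-order
  remainder is divided by at least \<open>norm b\<close>; if \<open>b = 0\<close>, the computed \<open>y\<close>, \<open>w\<close> and \<open>x\<close>
  vanish, so the denominator of the backward error is zero.
\<close>

section \<open>Pointwise estimates\<close>

lemma norm_matrix_vector_le: "norm (A *v x) \<le> mat_norm2 A * norm x"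
  for A :: "real^'n^'m"
  unfolding mat_norm2_def by (rule onorm) (rule matrix_vector_mul_bounded_linear)

lemma mat_norm2_nonneg: "0 \<le> mat_norm2 A"
  for A :: "real^'n^'m"
  unfolding mat_norm2_def by (rule onorm_pos_le) (rule matrix_vector_mul_bounded_linear)

lemma outer_prod_mult_vec: "outer_prod u v *v x = (v \<bullet> x) *\<^sub>R u"
  by (simp add: vec_eq_iff outer_prod_def matrix_vector_mult_def inner_vec_def
      sum_distrib_left sum_distrib_right mult_ac)

lemma norm_rank_one_update_le:
  "norm ((A + outer_prod u v) *v x) \<le> (mat_norm2 A + norm u * norm v) * norm x"
proof -
  have "norm ((A + outer_prod u v) *v x) \<le> norm (A *v x) + \<bar>v \<bullet> x\<bar> * norm u"
    by (metis matrix_vector_mult_add_rdistrib norm_scaleR norm_triangle_ineq outer_prod_mult_vec)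
  also have "\<dots> \<le> mat_norm2 A * norm x + (norm v * norm x) * norm u"
    by (intro add_mono mult_right_mono norm_matrix_vector_le Cauchy_Schwarz_ineq2) auto
  finally show ?thesis by (simp add: algebra_simps)
qed

text \<open>This turns small residuals into small errors of the solution. \<open>k\<close> bounds
  the norm of the inverse; adding 1 makes it strictly positive.\<close>

lemma invertible_bounded_below:
  fixes A :: "real^'n^'n"
  assumes "invertible A"
  obtains k where "0 < k" "\<And>x. norm x \<le> k * norm (A *v x)"
proof -
  obtain B where B: "B ** A = mat 1" using assms by (auto simp: invertible_def)
  show thesis
  proof
    show "0 < mat_norm2 B + 1" using mat_norm2_nonneg[of B] by linarith
    fix x
    have "norm x = norm (B *v (A *v x))" by (simp add: matrix_vector_mul_assoc B)
    also have "\<dots> \<le> mat_norm2 B * norm (A *v x)" by (rule norm_matrix_vector_le)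
    finally show "norm x \<le> (mat_norm2 B + 1) * norm (A *v x)"
      by (simp add: distrib_right add_increasing2)
  qed
qed

section \<open>Errors of single rounded operations and of stable solves\<close>

lemma fl_rounded_error: "fl_rounded eps a c \<Longrightarrow> \<bar>c - a\<bar> \<le> eps * \<bar>a\<bar>"
  unfolding fl_rounded_def by (clarsimp simp: distrib_left abs_mult) (metis abs_ge_zero mult.commute mult_right_mono)

lemma fl_rounded_vec_error:
  assumes "fl_rounded_vec eps a c" and "0 \<le> eps"
  shows "norm (c - a) \<le> eps * norm a"
proof -
  have "norm (c - a) \<le> norm (eps *\<^sub>R a)"
    using assms fl_rounded_error
    by (intro norm_le_componentwise_cart) (fastforce simp: fl_rounded_vec_def abs_mult)
  then show ?thesis using assms by simp
qed

lemma fl_inner_error: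
  fixes v w :: "real^'n"
  assumes "fl_inner eps v w c"
  shows "\<bar>c - v \<bullet> w\<bar> \<le> gamma_fl CARD('n) eps * (norm v * norm w)"
proof -
  let ?g = "gamma_fl CARD('n) eps"
  obtain D :: "real^'n^'n"
    where D: "\<And>i j. \<bar>D $ i $ j\<bar> \<le> (if i = j then ?g else 0)" and c: "c = v \<bullet> ((mat 1 + D) *v w)"
    using assms unfolding fl_inner_def by blast
  \<comment> \<open>A diagonal entry of \<open>D\<close> has its absolute value below
    \<open>?g\<close>.\<close>
  have g: "0 \<le> ?g"
    using D[of undefined undefined] by auto
  have offdiag: "D $ i $ j = 0" if "i \<noteq> j" for i j using D[of i j] that by auto
  have "(D *v w) $ i = D $ i $ i * w $ i" for i
    unfolding matrix_vector_mult_def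
    by simp (subst sum.remove[of _ i], auto intro!: sum.neutral simp: offdiag)
  moreover have "\<bar>D $ i $ i\<bar> \<le> ?g" for i using D[of i i] by simp
  ultimately have "norm (D *v w) \<le> norm (?g *\<^sub>R w)"
    using g by (intro norm_le_componentwise_cart) (auto simp: abs_mult intro!: mult_right_mono)
  then have "norm (D *v w) \<le> ?g * norm w" using g by simp
  moreover have "c - v \<bullet> w = v \<bullet> (D *v w)"
    by (simp add: c matrix_vector_mult_add_rdistrib inner_add_right)
  ultimately show ?thesis
    using Cauchy_Schwarz_ineq2[of v "D *v w"] mult_left_mono[of "norm (D *v w)" "?g * norm w" "norm v"]
    by (simp add: mult_ac)
qed

lemma stable_solve_residual:
  assumes "stable_solve cs eps A g s"
  shows "norm (A *v s - g) \<le> cs * eps * (mat_norm2 A * norm s + norm g)"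
proof -
  obtain dA dg where *: "(A + dA) *v s = g + dg" "mat_norm2 dA \<le> cs * eps * mat_norm2 A"
    "norm dg \<le> cs * eps * norm g"
    using assms unfolding stable_solve_def by blast
  have "A *v s - g = dg - dA *v s"
    using *(1) by (simp add: matrix_vector_mult_add_rdistrib algebra_simps)
  then have "norm (A *v s - g) \<le> norm dg + mat_norm2 dA * norm s"
    using norm_triangle_ineq4[of dg "dA *v s"] norm_matrix_vector_le[of dA s] by simp
  also have "\<dots> \<le> cs * eps * norm g + cs * eps * mat_norm2 A * norm s"
    using * by (intro add_mono mult_right_mono) auto
  finally show ?thesis by (simp add: algebra_simps)
qed

text \<open>The residual bound has \<open>norm s\<close> on both sides. At most half of it stands on
  the right and is absorbed on the left, which doubles the constant; the other factor 2 bounds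
  \<open>1 + cs * eps\<close>.\<close>

lemma stable_solve_norm_le:
  assumes "stable_solve cs eps A g s" and "0 < k" and "\<And>x. norm x \<le> k * norm (A *v x)"
    and "k * (cs * eps * mat_norm2 A) \<le> 1 / 2" and "cs * eps \<le> 1"
  shows "norm s \<le> 4 * k * norm g"
proof -
  have "norm (A *v s) \<le> norm g + cs * eps * (mat_norm2 A * norm s + norm g)"
    using stable_solve_residual[OF assms(1)] norm_triangle_sub[of "A *v s" g] by linarith
  then have "k * norm (A *v s) \<le> k * (norm g + cs * eps * (mat_norm2 A * norm s + norm g))"
    using assms(2) by (intro mult_left_mono) auto
  also have "\<dots> = k * norm g * (1 + cs * eps) + k * (cs * eps * mat_norm2 A) * norm s"
    by (simp add: algebra_simps)
  also have "\<dots> \<le> k * norm g * 2 + 1 / 2 * norm s"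
    using assms by (intro add_mono mult_mono mult_right_mono mult_left_mono) auto
  finally show ?thesis using assms(3)[of s] by linarith
qed

text \<open>\<open>b\<close> is rounded only in the subtraction, but
  \<open>\<theta> *\<^sub>R u\<close> is rounded as a product and again in the subtraction. Hence
  the factor \<open>2 + eps\<close>, the source of the surplus copy of
  \<open>eps * \<bar>\<theta>\<bar> * norm u\<close>.\<close>

lemma fl_update_error:
  assumes "fl_rounded_vec eps (\<theta> *\<^sub>R u) q" and "fl_rounded_vec eps (b - q) d" and "0 \<le> eps"
  shows "norm (d - (b - \<theta> *\<^sub>R u)) \<le> eps * norm b + eps * (2 + eps) * (\<bar>\<theta>\<bar> * norm u)"
proof -
  have q: "norm (q - \<theta> *\<^sub>R u) \<le> eps * (\<bar>\<theta>\<bar> * norm u)"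
    using fl_rounded_vec_error[OF assms(1,3)] by simp
  have d: "norm (d - (b - q)) \<le> eps * norm (b - q)"
    by (rule fl_rounded_vec_error[OF assms(2,3)])
  have "norm (b - q) \<le> norm b + (\<bar>\<theta>\<bar> * norm u + eps * (\<bar>\<theta>\<bar> * norm u))"
    using q norm_triangle_ineq4[of b q] norm_triangle_sub[of q "\<theta> *\<^sub>R u"] by simp
  from mult_left_mono[OF this assms(3)]
  have "norm (d - (b - q)) \<le> eps * (norm b + (\<bar>\<theta>\<bar> * norm u + eps * (\<bar>\<theta>\<bar> * norm u)))"
    using d by linarith
  moreover have "norm (d - (b - \<theta> *\<^sub>R u)) \<le> norm (d - (b - q)) + norm (q - \<theta> *\<^sub>R u)"
    using norm_triangle_ineq4[of "d - (b - q)" "q - \<theta> *\<^sub>R u"] by (simp add: algebra_simps)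
  ultimately show ?thesis using q by (simp add: algebra_simps)
qed

lemma fl_beta_error:
  fixes v z :: "real^'n"
  assumes "fl_inner eps v z t" and "fl_rounded eps (1 + t) \<beta>" and "0 \<le> eps"
  shows "\<bar>\<beta> - (1 + v \<bullet> z)\<bar> \<le> gamma_fl CARD('n) eps * (norm v * norm z)
    + eps * (1 + norm v * norm z + gamma_fl CARD('n) eps * (norm v * norm z))"
proof -
  let ?g = "gamma_fl CARD('n) eps * (norm v * norm z)"
  have t: "\<bar>t - v \<bullet> z\<bar> \<le> ?g" by (rule fl_inner_error[OF assms(1)])
  have "\<bar>1 + t\<bar> \<le> 1 + norm v * norm z + ?g"
    using t Cauchy_Schwarz_ineq2[of v z] by linarith
  from mult_left_mono[OF this assms(3)] fl_rounded_error[OF assms(2)] t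
  show ?thesis by linarith
qed

text \<open>Multiplying by \<open>\<beta>\<close> avoids a lower bound on its size. The roundings of
  the difference and of the quotient are relative to a small quantity; only the error of the inner
  product enters without a further factor \<open>eps\<close>.\<close>

lemma fl_theta1_error:
  fixes v w :: "real^'n"
  assumes "fl_inner eps v w s" and "fl_rounded eps (s - \<theta>) r" and "fl_rounded eps (r / \<beta>) \<theta>1"
    and "0 \<le> eps" and "\<beta> \<noteq> 0"
  shows "\<bar>\<theta>1 * \<beta> - (v \<bullet> w - \<theta>)\<bar> \<le> gamma_fl CARD('n) eps * (norm v * norm w)
    + eps * (2 + eps) * (\<bar>v \<bullet> w - \<theta>\<bar> + gamma_fl CARD('n) eps * (norm v * norm w))"
proof -
  let ?g = "gamma_fl CARD('n) eps * (norm v * norm w)"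
  let ?m = "\<bar>v \<bullet> w - \<theta>\<bar> + ?g"
  have s: "\<bar>s - v \<bullet> w\<bar> \<le> ?g" by (rule fl_inner_error[OF assms(1)])
  then have m: "\<bar>s - \<theta>\<bar> \<le> ?m" by linarith
  have r: "\<bar>r - (s - \<theta>)\<bar> \<le> eps * ?m"
    using fl_rounded_error[OF assms(2)] mult_left_mono[OF m assms(4)] by linarith
  then have "\<bar>r\<bar> \<le> ?m + eps * ?m" using m by linarith
  from mult_left_mono[OF this assms(4)] have "eps * \<bar>r\<bar> \<le> eps * (?m + eps * ?m)" .
  moreover have "\<bar>\<theta>1 * \<beta> - r\<bar> \<le> eps * \<bar>r\<bar>"
  proof -
    have "\<bar>\<theta>1 * \<beta> - r\<bar> = \<bar>\<theta>1 - r / \<beta>\<bar> * \<bar>\<beta>\<bar>"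
      using assms(5) by (simp add: abs_mult[symmetric] left_diff_distrib)
    also have "\<dots> \<le> eps * \<bar>r / \<beta>\<bar> * \<bar>\<beta>\<bar>"
      by (intro mult_right_mono fl_rounded_error[OF assms(3)]) auto
    also have "\<dots> = eps * \<bar>r\<bar>" using assms(5) by simp
    finally show ?thesis .
  qed
  moreover have "eps * (2 + eps) * ?m = eps * ?m + eps * (?m + eps * ?m)"
    by (simp add: algebra_simps)
  ultimately show ?thesis using r s by linarith
qed

text \<open>For \<open>t\<close> between 0 and 1/2, \<open>1 / (1 - t) \<le> 1 + 2 * t\<close>. So
  only \<open>n * eps\<close> counts towards the first-order constants.\<close>

lemma gamma_fl_le:
  assumes "0 \<le> eps" and "real n * eps \<le> 1 / 2"
  shows "gamma_fl n eps \<le> real n * eps + 2 * (real n)\<^sup>2 * eps\<^sup>2"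
proof -
  let ?t = "real n * eps"
  have t0: "0 \<le> ?t" using assms by simp
  have "?t * (2 * ?t) \<le> ?t * 1" using t0 assms by (intro mult_left_mono) auto
  then have "0 \<le> ?t * ?t * (1 - 2 * ?t)" using t0 assms by auto
  then have "?t \<le> (?t + 2 * ?t\<^sup>2) * (1 - ?t)" by (simp add: algebra_simps power2_eq_square)
  then show ?thesis
    using assms by (simp add: gamma_fl_def divide_le_eq power_mult_distrib mult.assoc)
qed

text \<open>If the denominator vanished, \<open>z\<close> would lie in the kernel of the updated
  matrix and hence be 0, but then the denominator would be 1.\<close>

lemma sherman_morrison_denominator_nonzero:
  fixes A :: "real^'n^'n"
  assumes "invertible (A + outer_prod u v)" and "A *v z = u"
  shows "1 + v \<bullet> z \<noteq> 0"
proof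
  assume 0: "1 + v \<bullet> z = 0"
  have "(A + outer_prod u v) *v z = (1 + v \<bullet> z) *\<^sub>R u"
    by (simp add: matrix_vector_mult_add_rdistrib outer_prod_mult_vec assms(2) algebra_simps)
  then have "(A + outer_prod u v) *v z = 0" using 0 by simp
  moreover obtain k where "norm z \<le> k * norm ((A + outer_prod u v) *v z)"
    using invertible_bounded_below[OF assms(1)] by metis
  ultimately have "z = 0" by simp
  then show False using 0 by simp
qed

text \<open>A telescoping identity for arbitrary values of the variables: each summand is the defect
  of one computed line of the algorithm. Inserting \<open>\<theta>1 * \<beta>\<close> separates the
  error of \<open>\<beta>\<close> from that of \<open>\<theta>1\<close>.\<close>

lemma backward_error_residual_decomposition:
  fixes A :: "real^'n^'n"
  shows "b - (A + outer_prod u v) *v x =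
    (b - \<theta> *\<^sub>R u - d) + (d - A *v w) - (A + outer_prod u v) *v (x - (w - p))
    + (A + outer_prod u v) *v (p - \<theta>1 *\<^sub>R z) + \<theta>1 *\<^sub>R (A *v z - u)
    - (\<theta>1 * (\<beta> - (1 + v \<bullet> z))) *\<^sub>R u + (\<theta>1 * \<beta> - (v \<bullet> w - \<theta>)) *\<^sub>R u"
  by (simp add: matrix_vector_mult_add_rdistrib outer_prod_mult_vec matrix_vector_mult_diff_distrib
      matrix_vector_mult_scaleR inner_diff_right algebra_simps)

section \<open>Families of runs\<close>

lemma bigo_bound:
  fixes f h g :: "'i \<Rightarrow> real"
  assumes "\<forall>\<^sub>F i in F. \<bar>f i\<bar> \<le> h i" and "h \<in> O[F](g)"
  shows "f \<in> O[F](g)"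
proof -
  have "f \<in> O[F](h)"
    using assms(1) by (intro bigoI[of _ 1]) (auto elim!: eventually_mono)
  then show ?thesis using assms(2) by (rule landau_o.big_trans)
qed

lemma bigo_norm_bound:
  fixes h g :: "'i \<Rightarrow> real"
  assumes "\<forall>\<^sub>F i in F. norm (f i) \<le> h i" and "h \<in> O[F](g)"
  shows "(\<lambda>i. norm (f i)) \<in> O[F](g)"
  using assms by - (rule bigo_bound[of _ h], auto)

(* The index i ranges over runs with varying unit roundoff e i, and the filter F expresses
   e i -> 0.  Thus O[F] is uniform in the rounding errors, as the O(eps^2) of the theorem. *)
locale msm_family =
  fixes F :: "'i filter" and e :: "'i \<Rightarrow> real" and A :: "real^'n^'n" and u v b :: "real^'n"
    and cs :: real and y z d w p x :: "'i \<Rightarrow> real^'n" and \<alpha> \<beta> \<theta> \<theta>1 :: "'i \<Rightarrow> real"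
  assumes eps_tendsto: "(e \<longlongrightarrow> 0) F"
    and eps_pos: "\<forall>\<^sub>F i in F. 0 < e i"
    and run: "\<forall>\<^sub>F i in F. msm_run cs (e i) A u v b (y i) (z i) (\<alpha> i) (\<beta> i) (\<theta> i) (d i) (w i)
      (\<theta>1 i) (p i) (x i)"
    and beta_nonzero: "\<forall>\<^sub>F i in F. \<beta> i \<noteq> 0"
    and A_invertible: "invertible A"
    and update_invertible: "invertible (A + outer_prod u v)"
    and cs_nonneg: "0 \<le> cs"
begin

lemma eventually_mult_eps_le: "0 < r \<Longrightarrow> \<forall>\<^sub>F i in F. c * e i \<le> r"
  using order_tendstoD(2)[OF tendsto_mult_right_zero[OF eps_tendsto], of r c]
  by (auto elim!: eventually_mono)

lemma eps_bigo_1: "e \<in> O[F](\<lambda>_. 1)"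
  by (rule bigoI_tendsto[where c = 0]) (use eps_tendsto in auto)

lemma bigo_eps_mult: "f \<in> O[F](\<lambda>_. 1) \<Longrightarrow> (\<lambda>i. e i * f i) \<in> O[F](e)"
  by (rule landau_o.big_1_mult) auto

lemma bigo_mult_1_left: "f \<in> O[F](\<lambda>_. 1) \<Longrightarrow> g \<in> O[F](h) \<Longrightarrow> (\<lambda>i. f i * g i) \<in> O[F](h)"
  using landau_o.big_1_mult[of g F h f] by (simp add: mult.commute)

lemma bigo_mult_eps_sq:
  "f \<in> O[F](e) \<Longrightarrow> g \<in> O[F](e) \<Longrightarrow> (\<lambda>i. f i * g i) \<in> O[F](\<lambda>i. (e i)\<^sup>2)"
  unfolding power2_eq_square by (rule landau_o.big.mult)

lemma bigo_eps_imp_1: "f \<in> O[F](e) \<Longrightarrow> f \<in> O[F](\<lambda>_. 1)"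
  using eps_bigo_1 landau_o.big_trans by blast

lemmas bigo_1_intros = sum_in_bigo landau_o.big.mult_in_1 bigo_const eps_bigo_1

section \<open>Gamma and the stable solves as the roundoff tends to 0\<close>

lemma gamma_bounds: "\<forall>\<^sub>F i in F. 0 \<le> gamma_fl CARD('n) (e i) \<and>
    gamma_fl CARD('n) (e i) \<le> real CARD('n) * e i + 2 * (real CARD('n))\<^sup>2 * (e i)\<^sup>2"
  using eps_pos eventually_mult_eps_le[of "1/2" "real CARD('n)", simplified]
proof eventually_elim
  case (elim i)
  then have "real CARD('n) * e i \<le> 1 / 2" by simp
  with elim show ?case using gamma_fl_le[of "e i" "CARD('n)"] by (auto simp: gamma_fl_def)
qed

lemma gamma_bigo: "(\<lambda>i. gamma_fl CARD('n) (e i)) \<in> O[F](e)"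
proof (rule bigo_bound)
  show "\<forall>\<^sub>F i in F. \<bar>gamma_fl CARD('n) (e i)\<bar> \<le> e i * (real CARD('n) + 2 * (real CARD('n))\<^sup>2 * e i)"
    using gamma_bounds by eventually_elim (auto simp: algebra_simps power2_eq_square)
qed (intro bigo_eps_mult bigo_1_intros)

text \<open>Solves are controlled through their residuals, so orders are checked after applying
  \<open>A\<close>; boundedness below carries them back.\<close>

lemma preimage_bigo:
  assumes "(\<lambda>i. norm (A *v f i)) \<in> O[F](g)"
  shows "(\<lambda>i. norm (f i)) \<in> O[F](g)"
proof -
  obtain k where "\<And>x. norm x \<le> k * norm (A *v x)"
    using invertible_bounded_below[OF A_invertible] by metis
  then show ?thesis using assms
    by - (rule bigo_norm_bound[where h = "\<lambda>i. k * norm (A *v f i)"], auto)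
qed

text \<open>\<open>K\<close> is chosen before \<open>g\<close> and \<open>s\<close>, so it serves
  every right-hand side; for \<open>g = 0\<close> it forces \<open>s = 0\<close>.\<close>

lemma eventually_solve_norm_le:
  "\<exists>K. \<forall>\<^sub>F i in F. \<forall>g s. stable_solve cs (e i) A g s \<longrightarrow> norm s \<le> K * norm g"
proof -
  obtain k where k: "0 < k" "\<And>x. norm x \<le> k * norm (A *v x)"
    using invertible_bounded_below[OF A_invertible] by metis
  have "\<forall>\<^sub>F i in F. \<forall>g s. stable_solve cs (e i) A g s \<longrightarrow> norm s \<le> 4 * k * norm g"
    using eventually_mult_eps_le[of "1/2" "k * cs * mat_norm2 A", simplified]
      eventually_mult_eps_le[of 1 cs, simplified]
  proof eventually_elim
    case (elim i)
    then show ?case using stable_solve_norm_le[OF _ k] by (auto simp: mult_ac)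
  qed
  then show ?thesis by blast
qed

lemma solve_bigo:
  assumes "\<forall>\<^sub>F i in F. stable_solve cs (e i) A (g i) (s i)" and g: "(\<lambda>i. norm (g i)) \<in> O[F](\<lambda>_. 1)"
  shows "(\<lambda>i. norm (s i)) \<in> O[F](\<lambda>_. 1)" and "(\<lambda>i. norm (A *v s i - g i)) \<in> O[F](e)"
proof -
  obtain K where K: "\<forall>\<^sub>F i in F. \<forall>g s. stable_solve cs (e i) A g s \<longrightarrow> norm s \<le> K * norm g"
    using eventually_solve_norm_le by blast
  show s: "(\<lambda>i. norm (s i)) \<in> O[F](\<lambda>_. 1)"
  proof (rule bigo_norm_bound)
    show "\<forall>\<^sub>F i in F. norm (s i) \<le> K * norm (g i)"
      using K assms(1) by eventually_elim auto
  qed (intro bigo_1_intros g)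
  show "(\<lambda>i. norm (A *v s i - g i)) \<in> O[F](e)"
  proof (rule bigo_norm_bound)
    show "\<forall>\<^sub>F i in F. norm (A *v s i - g i) \<le> e i * (cs * (mat_norm2 A * norm (s i) + norm (g i)))"
      using assms(1) by eventually_elim (use stable_solve_residual in \<open>fastforce simp: mult_ac\<close>)
  qed (intro bigo_eps_mult bigo_1_intros g s)
qed

lemma inner_bigo:
  "(\<lambda>i. norm (f i)) \<in> O[F](g) \<Longrightarrow> (\<lambda>i. v \<bullet> f i) \<in> O[F](g)"
  by (rule bigo_bound[where h = "\<lambda>i. norm v * norm (f i)"])
    (auto simp: Cauchy_Schwarz_ineq2 intro: bigo_mult_1_left)

section \<open>Orders of magnitude of the computed quantities\<close>

lemma runD:
  "\<forall>\<^sub>F i in F. stable_solve cs (e i) A b (y i)"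
  "\<forall>\<^sub>F i in F. stable_solve cs (e i) A u (z i)"
  "\<forall>\<^sub>F i in F. stable_solve cs (e i) A (d i) (w i)"
  "\<forall>\<^sub>F i in F. fl_inner (e i) v (y i) (\<alpha> i)"
  "\<forall>\<^sub>F i in F. fl_rounded (e i) (\<alpha> i / \<beta> i) (\<theta> i)"
  "\<forall>\<^sub>F i in F. fl_rounded_vec (e i) (\<theta>1 i *\<^sub>R z i) (p i)"
  "\<forall>\<^sub>F i in F. fl_rounded_vec (e i) (w i - p i) (x i)"
  by (rule eventually_mono[OF run]; unfold msm_run_def; blast)+

lemmas y_bigo = solve_bigo[OF runD(1), simplified]
lemmas z_bigo = solve_bigo[OF runD(2), simplified]

lemma alpha_error_bigo: "(\<lambda>i. \<alpha> i - v \<bullet> y i) \<in> O[F](e)"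
proof (rule bigo_bound)
  show "\<forall>\<^sub>F i in F. \<bar>\<alpha> i - v \<bullet> y i\<bar> \<le> gamma_fl CARD('n) (e i) * (norm v * norm (y i))"
    using runD(4) by eventually_elim (rule fl_inner_error)
qed (intro landau_o.big_1_mult gamma_bigo bigo_1_intros y_bigo)

lemma alpha_bigo: "\<alpha> \<in> O[F](\<lambda>_. 1)"
  using sum_in_bigo(1)[OF bigo_eps_imp_1[OF alpha_error_bigo] inner_bigo[OF y_bigo(1)]] by simp

lemma beta_error_bigo: "(\<lambda>i. \<beta> i - (1 + v \<bullet> z i)) \<in> O[F](e)"
proof (rule bigo_bound)
  show "\<forall>\<^sub>F i in F. \<bar>\<beta> i - (1 + v \<bullet> z i)\<bar> \<le> gamma_fl CARD('n) (e i) * (norm v * norm (z i))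
      + e i * (1 + norm v * norm (z i) + gamma_fl CARD('n) (e i) * (norm v * norm (z i)))"
    using run eps_pos
    by eventually_elim (auto simp: msm_run_def intro!: fl_beta_error)
qed (intro landau_o.big_1_mult bigo_eps_mult sum_in_bigo(1)[of _ _ e] gamma_bigo bigo_1_intros
      bigo_eps_imp_1[OF gamma_bigo] z_bigo)

text \<open>That each \<open>\<beta> i\<close> is nonzero does not bound the reciprocals.
  Invertibility of the updated matrix does: \<open>z i\<close> tends to the exact solution, so
  \<open>\<beta> i\<close> tends to the exact denominator, which is nonzero.\<close>

lemma inverse_beta_bigo: "(\<lambda>i. 1 / \<beta> i) \<in> O[F](\<lambda>_. 1)"
proof -
  obtain B where "A ** B = mat 1" using A_invertible by (auto simp: invertible_def)
  then have z0: "A *v (B *v u) = u" by (simp add: matrix_vector_mul_assoc)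
  define z0 where "z0 = B *v u"
  define \<beta>0 where "\<beta>0 = 1 + v \<bullet> z0"
  have "\<beta>0 \<noteq> 0"
    unfolding \<beta>0_def z0_def
    by (rule sherman_morrison_denominator_nonzero[OF update_invertible z0])
  have "(\<lambda>i. norm (z i - z0)) \<in> O[F](e)"
    by (rule preimage_bigo) (use z_bigo(2) in \<open>simp add: matrix_vector_mult_diff_distrib z0_def z0\<close>)
  from sum_in_bigo(1)[OF inner_bigo[OF this] beta_error_bigo]
  have "(\<lambda>i. \<beta> i - \<beta>0) \<in> O[F](e)" by (simp add: \<beta>0_def inner_diff_right algebra_simps)
  moreover have "e \<in> o[F](\<lambda>_. 1)" by (rule smalloI_tendsto) (use eps_tendsto in auto)
  ultimately have "(\<lambda>i. \<beta> i - \<beta>0) \<in> o[F](\<lambda>_. 1)" by (rule landau_o.big_small_trans)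
  then have "((\<lambda>i. \<beta> i - \<beta>0) \<longlongrightarrow> 0) F" using smalloD_tendsto by fastforce
  then have "(\<beta> \<longlongrightarrow> \<beta>0) F" using LIM_zero_iff by blast
  then have "((\<lambda>i. 1 / \<beta> i) \<longlongrightarrow> 1 / \<beta>0) F" using \<open>\<beta>0 \<noteq> 0\<close> by (intro tendsto_intros)
  then show ?thesis by (intro bigoI_tendsto) auto
qed

lemma beta_bigo: "\<beta> \<in> O[F](\<lambda>_. 1)"
proof -
  have "(\<lambda>i. 1 + v \<bullet> z i) \<in> O[F](\<lambda>_. 1)"
    by (intro bigo_1_intros inner_bigo z_bigo)
  from sum_in_bigo(1)[OF bigo_eps_imp_1[OF beta_error_bigo] this] show ?thesis by simp
qed

lemma theta_error_bigo: "(\<lambda>i. \<theta> i - \<alpha> i / \<beta> i) \<in> O[F](e)"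
proof (rule bigo_bound)
  show "\<forall>\<^sub>F i in F. \<bar>\<theta> i - \<alpha> i / \<beta> i\<bar> \<le> e i * \<bar>\<alpha> i * (1 / \<beta> i)\<bar>"
    using runD(5) by eventually_elim (use fl_rounded_error in force)
qed (rule bigo_eps_mult, subst landau_o.big.abs_in_iff,
    rule landau_o.big.mult_in_1[OF alpha_bigo inverse_beta_bigo])

lemma theta_bigo: "\<theta> \<in> O[F](\<lambda>_. 1)"
  using sum_in_bigo(1)[OF bigo_eps_imp_1[OF theta_error_bigo]
      landau_o.big.mult_in_1[OF alpha_bigo inverse_beta_bigo]] by simp

lemma update_error: "\<forall>\<^sub>F i in F. norm (d i - (b - \<theta> i *\<^sub>R u)) \<le>
    e i * norm b + e i * (2 + e i) * (\<bar>\<theta> i\<bar> * norm u)"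
  using run eps_pos by eventually_elim (auto simp: msm_run_def intro!: fl_update_error)

lemma update_error_bigo: "(\<lambda>i. norm (d i - (b - \<theta> i *\<^sub>R u))) \<in> O[F](e)"
proof (rule bigo_norm_bound)
  show "\<forall>\<^sub>F i in F. norm (d i - (b - \<theta> i *\<^sub>R u)) \<le> e i * (norm b + (2 + e i) * (\<bar>\<theta> i\<bar> * norm u))"
    using update_error by eventually_elim (simp add: algebra_simps)
qed (intro bigo_eps_mult bigo_1_intros, simp add: theta_bigo)

lemma d_bigo: "(\<lambda>i. norm (d i)) \<in> O[F](\<lambda>_. 1)"
proof (rule bigo_norm_bound)
  show "\<forall>\<^sub>F i in F. norm (d i) \<le> norm (d i - (b - \<theta> i *\<^sub>R u)) + (norm b + \<bar>\<theta> i\<bar> * norm u)"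
  proof (rule always_eventually, rule allI)
    fix i
    show "norm (d i) \<le> norm (d i - (b - \<theta> i *\<^sub>R u)) + (norm b + \<bar>\<theta> i\<bar> * norm u)"
      using norm_triangle_sub[of "d i" "b - \<theta> i *\<^sub>R u"] norm_triangle_ineq4[of b "\<theta> i *\<^sub>R u"] by simp
  qed
qed (intro bigo_1_intros bigo_eps_imp_1[OF update_error_bigo], simp add: theta_bigo)

lemmas w_bigo = solve_bigo[OF runD(3) d_bigo]

text \<open>Up to first-order errors \<open>A\<close> maps \<open>w\<close> to \<open>d\<close>,
  \<open>d\<close> is \<open>b - \<theta> *\<^sub>R u\<close>, and this is the image of
  \<open>y - \<theta> *\<^sub>R z\<close> under \<open>A\<close>.\<close>

lemma w_approx_bigo: "(\<lambda>i. norm (w i - (y i - \<theta> i *\<^sub>R z i))) \<in> O[F](e)"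
proof (rule preimage_bigo, rule bigo_norm_bound)
  show "\<forall>\<^sub>F i in F. norm (A *v (w i - (y i - \<theta> i *\<^sub>R z i))) \<le> norm (A *v w i - d i)
     + norm (d i - (b - \<theta> i *\<^sub>R u)) + norm (A *v y i - b) + \<bar>\<theta> i\<bar> * norm (A *v z i - u)"
  proof (rule always_eventually, rule allI)
    fix i
    have "A *v (w i - (y i - \<theta> i *\<^sub>R z i)) =
        (A *v w i - d i) + (d i - (b - \<theta> i *\<^sub>R u)) - (A *v y i - b) + \<theta> i *\<^sub>R (A *v z i - u)"
      by (simp add: matrix_vector_mult_diff_distrib matrix_vector_mult_scaleR algebra_simps)
    then show "norm (A *v (w i - (y i - \<theta> i *\<^sub>R z i))) \<le> norm (A *v w i - d i)
     + norm (d i - (b - \<theta> i *\<^sub>R u)) + norm (A *v y i - b) + \<bar>\<theta> i\<bar> * norm (A *v z i - u)"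
      by (simp only:) (intro norm_triangle_le norm_triangle_le_diff add_mono order_refl, simp)
  qed
qed (intro sum_in_bigo w_bigo update_error_bigo y_bigo bigo_mult_1_left z_bigo, simp add: theta_bigo)

text \<open>If \<open>w = y - \<theta> *\<^sub>R z\<close>, \<open>\<alpha> = v \<bullet> y\<close>,
  \<open>\<theta> = \<alpha> / \<beta>\<close> and \<open>\<beta> = 1 + v \<bullet> z\<close> held
  exactly, then \<open>v \<bullet> w = \<theta>\<close> would follow. The four summands in
  \<open>*\<close> are the defects of these relations.\<close>

lemma theta_residual_bigo: "(\<lambda>i. v \<bullet> w i - \<theta> i) \<in> O[F](e)"
proof -
  have *: "(\<lambda>i. v \<bullet> (w i - (y i - \<theta> i *\<^sub>R z i)) - (\<alpha> i - v \<bullet> y i)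
      - \<beta> i * (\<theta> i - \<alpha> i / \<beta> i) + \<theta> i * (\<beta> i - (1 + v \<bullet> z i))) \<in> O[F](e)"
    by (intro sum_in_bigo inner_bigo w_approx_bigo alpha_error_bigo bigo_mult_1_left beta_bigo
        theta_error_bigo theta_bigo beta_error_bigo)
  show ?thesis
  proof (rule landau_o.big.in_cong[THEN iffD2, OF _ *])
    show "\<forall>\<^sub>F i in F. v \<bullet> w i - \<theta> i = v \<bullet> (w i - (y i - \<theta> i *\<^sub>R z i)) - (\<alpha> i - v \<bullet> y i)
      - \<beta> i * (\<theta> i - \<alpha> i / \<beta> i) + \<theta> i * (\<beta> i - (1 + v \<bullet> z i))"
      using beta_nonzero by eventually_elim (simp add: inner_diff_right algebra_simps)
  qed
qed

lemma theta1_error: "\<forall>\<^sub>F i in F. \<bar>\<theta>1 i * \<beta> i - (v \<bullet> w i - \<theta> i)\<bar> \<le>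
    gamma_fl CARD('n) (e i) * (norm v * norm (w i))
    + e i * (2 + e i) * (\<bar>v \<bullet> w i - \<theta> i\<bar> + gamma_fl CARD('n) (e i) * (norm v * norm (w i)))"
  using run eps_pos beta_nonzero
  by eventually_elim (auto simp: msm_run_def intro!: fl_theta1_error)

text \<open>The bracket is already of first order, and the roundings of the difference and the
  quotient supply another factor \<open>e\<close>.\<close>

lemma theta1_second_order_bigo:
  "(\<lambda>i. e i * (2 + e i) * (\<bar>v \<bullet> w i - \<theta> i\<bar> + gamma_fl CARD('n) (e i) * (norm v * norm (w i))))
    \<in> O[F](\<lambda>i. (e i)\<^sup>2)"
  by (intro bigo_mult_eps_sq bigo_eps_mult sum_in_bigo(1)[of _ _ e] landau_o.big_1_mult gamma_bigo
      bigo_1_intros w_bigo) (simp add: theta_residual_bigo)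

lemma eps_sq_bigo: "(\<lambda>i. (e i)\<^sup>2) \<in> O[F](e)"
  unfolding power2_eq_square by (intro bigo_eps_mult eps_bigo_1)

text \<open>The numerator \<open>v \<bullet> w - \<theta>\<close> is of first order and
  \<open>1 / \<beta>\<close> is bounded. All later rounding errors relative to
  \<open>\<theta>1\<close> thereby become second order.\<close>

lemma theta1_bigo: "\<theta>1 \<in> O[F](e)"
proof -
  have "(\<lambda>i. \<theta>1 i * \<beta> i - (v \<bullet> w i - \<theta> i)) \<in> O[F](e)"
    using theta1_error
    by (rule bigo_bound) (intro sum_in_bigo landau_o.big_1_mult gamma_bigo bigo_1_intros w_bigo
        landau_o.big_trans[OF theta1_second_order_bigo eps_sq_bigo])
  from sum_in_bigo(1)[OF this theta_residual_bigo] have "(\<lambda>i. \<theta>1 i * \<beta> i) \<in> O[F](e)" by simp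
  from landau_o.big_1_mult[OF this inverse_beta_bigo]
  show ?thesis
    by (rule landau_o.big.ev_eq_trans2[rotated])
      (use beta_nonzero in \<open>auto elim!: eventually_mono\<close>)
qed

lemma p_error_bigo: "(\<lambda>i. norm (p i - \<theta>1 i *\<^sub>R z i)) \<in> O[F](\<lambda>i. (e i)\<^sup>2)"
proof (rule bigo_norm_bound)
  show "\<forall>\<^sub>F i in F. norm (p i - \<theta>1 i *\<^sub>R z i) \<le> e i * (\<bar>\<theta>1 i\<bar> * norm (z i))"
    using runD(6) eps_pos by eventually_elim (use fl_rounded_vec_error in fastforce)
qed (intro bigo_mult_eps_sq landau_o.big_1_mult z_bigo, auto simp: theta1_bigo)

lemma p_bigo: "(\<lambda>i. norm (p i)) \<in> O[F](e)"
proof (rule bigo_norm_bound)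
  show "\<forall>\<^sub>F i in F. norm (p i) \<le> norm (p i - \<theta>1 i *\<^sub>R z i) + \<bar>\<theta>1 i\<bar> * norm (z i)"
    by (intro always_eventually allI) (metis add.commute norm_scaleR norm_triangle_sub)
qed (intro sum_in_bigo landau_o.big_1_mult z_bigo landau_o.big_trans[OF p_error_bigo eps_sq_bigo],
    simp add: theta1_bigo)

section \<open>From the computed solution to its backward error\<close>

lemma x_error: "\<forall>\<^sub>F i in F. norm (x i - (w i - p i)) \<le> e i * (norm (w i) + norm (p i))"
  using runD(7) eps_pos
proof eventually_elim
  case (elim i)
  then have "norm (x i - (w i - p i)) \<le> e i * norm (w i - p i)"
    by (intro fl_rounded_vec_error) auto
  also have "\<dots> \<le> e i * (norm (w i) + norm (p i))"
    using elim by (intro mult_left_mono norm_triangle_ineq4) auto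
  finally show ?case .
qed

text \<open>Allows \<open>norm w\<close> to be replaced by \<open>norm x\<close> in first-order
  terms at second-order cost.\<close>

lemma x_approx_bigo: "(\<lambda>i. norm (w i - x i)) \<in> O[F](e)"
proof (rule bigo_norm_bound)
  show "\<forall>\<^sub>F i in F. norm (w i - x i) \<le> e i * (norm (w i) + norm (p i)) + norm (p i)"
    using x_error
  proof eventually_elim
    case (elim i)
    have "norm (w i - x i) \<le> norm (x i - (w i - p i)) + norm (p i)"
      using norm_triangle_ineq4[of "p i" "x i - (w i - p i)"] by simp
    then show ?case using elim by simp
  qed
qed (intro sum_in_bigo(1)[of _ _ e] bigo_eps_mult bigo_1_intros w_bigo p_bigo bigo_eps_imp_1[OF p_bigo])

text \<open>First-order terms keep explicit constants. The coefficient obtained for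
  \<open>N * norm x\<close> is \<open>2 + cs + c\<close>: one unit absorbs the surplus error of
  \<open>d\<close>, one bounds the rounding of \<open>x\<close>, \<open>cs\<close> comes from the
  solve for \<open>w\<close>, and \<open>c\<close> from the inner product in
  \<open>\<theta>1\<close>. It is relaxed to the stated constant only at the end.\<close>

lemma residual_bound:
  fixes N c :: real
  defines "N \<equiv> mat_norm2 A + norm u * norm v" and "c \<equiv> real CARD('n)"
  shows "\<exists>g\<in>O[F](\<lambda>i. (e i)\<^sup>2). \<forall>\<^sub>F i in F. norm (b - (A + outer_prod u v) *v x i) \<le>
    e i * (2 * c + 4 + 2 * cs) * (N * (norm (x i) + norm (p i)))
    + e i * (1 + cs) * (norm u * (\<bar>\<theta> i\<bar> + \<bar>\<theta>1 i\<bar>) + norm b) + g i"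
proof
  define M where "M = A + outer_prod u v"
  define \<rho>d where "\<rho>d i = norm (d i - (b - \<theta> i *\<^sub>R u))" for i
  define \<rho>\<theta> where "\<rho>\<theta> i = \<bar>v \<bullet> w i - \<theta> i\<bar>" for i
  define \<rho>p where "\<rho>p i = norm (p i - \<theta>1 i *\<^sub>R z i)" for i
  define \<rho>x where "\<rho>x i = norm (w i - x i)" for i
  define \<rho>z where "\<rho>z i = norm (A *v z i - u)" for i
  define \<rho>\<beta> where "\<rho>\<beta> i = \<bar>\<beta> i - (1 + v \<bullet> z i)\<bar>" for i
  define q where "q i = e i * (2 + e i) * (\<rho>\<theta> i + gamma_fl CARD('n) (e i) * (norm v * norm (w i)))" for i
  \<comment> \<open>Each summand has two first-order factors or one second-order factor. The one
    with \<open>e i * \<rho>\<theta> i\<close> pays for replacing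
    \<open>\<bar>\<theta>\<bar>\<close> by \<open>norm v * norm w\<close>, the last one for
    replacing \<open>norm w\<close> by \<open>norm x\<close>.\<close>
  define g where "g i = (e i)\<^sup>2 * (\<bar>\<theta> i\<bar> * norm u) + e i * (\<rho>\<theta> i * norm u) + e i * (cs * \<rho>d i)
    + e i * (norm (p i) * N) + \<rho>p i * N + \<bar>\<theta>1 i\<bar> * \<rho>z i + \<bar>\<theta>1 i\<bar> * \<rho>\<beta> i * norm u
    + (e i)\<^sup>2 * (2 * c\<^sup>2 * norm u * norm v * norm (w i)) + q i * norm u
    + e i * (\<rho>x i * ((2 + cs + c) * N))" for i
  have N0: "0 \<le> N" "mat_norm2 A \<le> N" "norm u * norm v \<le> N"
    using mat_norm2_nonneg[of A] by (auto simp: N_def)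
  have c0: "0 \<le> c" by (simp add: c_def)
  have \<rho>: "\<rho>d \<in> O[F](e)" "\<rho>\<theta> \<in> O[F](e)" "\<rho>p \<in> O[F](\<lambda>i. (e i)\<^sup>2)" "\<rho>x \<in> O[F](e)" "\<rho>z \<in> O[F](e)"
    "\<rho>\<beta> \<in> O[F](e)" "q \<in> O[F](\<lambda>i. (e i)\<^sup>2)"
    unfolding \<rho>d_def[abs_def] \<rho>\<theta>_def[abs_def] \<rho>p_def[abs_def] \<rho>x_def[abs_def] \<rho>z_def[abs_def]
      \<rho>\<beta>_def[abs_def] q_def[abs_def] landau_o.big.abs_in_iff
    by (rule update_error_bigo theta_residual_bigo p_error_bigo x_approx_bigo z_bigo beta_error_bigo
        theta1_second_order_bigo)+
  have abs: "(\<lambda>i. \<bar>\<theta> i\<bar>) \<in> O[F](\<lambda>_. 1)" "(\<lambda>i. \<bar>\<theta>1 i\<bar>) \<in> O[F](e)"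
    by (simp_all add: theta_bigo theta1_bigo)
  show "g \<in> O[F](\<lambda>i. (e i)\<^sup>2)"
    unfolding g_def[abs_def]
    apply (intro sum_in_bigo(1))
    subgoal by (rule landau_o.big_1_mult) (intro landau_o.big_refl bigo_1_intros abs)+
    subgoal by (intro bigo_mult_eps_sq landau_o.big_1_mult landau_o.big_refl \<rho> bigo_const)
    subgoal by (intro bigo_mult_eps_sq bigo_mult_1_left landau_o.big_refl \<rho> bigo_const)
    subgoal by (intro bigo_mult_eps_sq landau_o.big_1_mult landau_o.big_refl p_bigo bigo_const)
    subgoal by (intro landau_o.big_1_mult \<rho> bigo_const)
    subgoal by (intro bigo_mult_eps_sq abs \<rho>)
    subgoal by (rule landau_o.big_1_mult) (intro bigo_mult_eps_sq abs \<rho> bigo_const)+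
    subgoal by (rule landau_o.big_1_mult) (intro landau_o.big_refl bigo_1_intros w_bigo)+
    subgoal by (intro landau_o.big_1_mult \<rho> bigo_const)
    subgoal by (intro bigo_mult_eps_sq landau_o.big_1_mult landau_o.big_refl \<rho> bigo_const)
    done
  show "\<forall>\<^sub>F i in F. norm (b - (A + outer_prod u v) *v x i) \<le>
    e i * (2 * c + 4 + 2 * cs) * (N * (norm (x i) + norm (p i)))
    + e i * (1 + cs) * (norm u * (\<bar>\<theta> i\<bar> + \<bar>\<theta>1 i\<bar>) + norm b) + g i"
    using eps_pos gamma_bounds update_error runD(3) x_error theta1_error
  proof eventually_elim
    case (elim i)
    define E W X P T B where "E = e i" and "W = norm (w i)" and "X = norm (x i)" and "P = norm (p i)"
      and "T = \<bar>\<theta> i\<bar> * norm u" and "B = norm b"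
    have pos: "0 < E" "0 \<le> W" "0 \<le> X" "0 \<le> P" "0 \<le> T" "0 \<le> B"
      using elim(1) by (auto simp: E_def W_def X_def P_def T_def B_def)
    note E_def[symmetric, simp] W_def[symmetric, simp] X_def[symmetric, simp] P_def[symmetric, simp]
      T_def[symmetric, simp] B_def[symmetric, simp]
    have MN: "norm (M *v a) \<le> N * norm a" for a
      unfolding M_def N_def by (rule norm_rank_one_update_le)
    have d1: "\<rho>d i \<le> E * B + E * (2 + E) * T" using elim(3) by (simp add: \<rho>d_def)
    have "norm (d i) \<le> B + T + \<rho>d i"
      using norm_triangle_sub[of "d i" "b - \<theta> i *\<^sub>R u"] norm_triangle_ineq4[of b "\<theta> i *\<^sub>R u"]
      by (simp add: \<rho>d_def)
    then have "cs * E * (mat_norm2 A * W + norm (d i)) \<le> cs * E * (mat_norm2 A * W + (B + T + \<rho>d i))"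
      using pos cs_nonneg by (intro mult_left_mono) auto
    then have solve: "norm (d i - A *v w i) \<le> cs * E * (mat_norm2 A * W + (B + T + \<rho>d i))"
      using stable_solve_residual[OF elim(4)] by (simp add: norm_minus_commute)
    have x1: "norm (M *v (x i - (w i - p i))) \<le> N * (E * (W + P))"
      using MN[of "x i - (w i - p i)"] mult_left_mono[OF elim(5) N0(1)] by simp
    have p1: "norm (M *v (p i - \<theta>1 i *\<^sub>R z i)) \<le> N * \<rho>p i"
      using MN by (simp add: \<rho>p_def)
    have "gamma_fl CARD('n) (e i) * (norm v * W) \<le> (c * E + 2 * c\<^sup>2 * E\<^sup>2) * (norm v * W)"
      using elim(2) pos by (intro mult_right_mono) (auto simp: c_def)
    then have "\<bar>\<theta>1 i * \<beta> i - (v \<bullet> w i - \<theta> i)\<bar> \<le> (c * E + 2 * c\<^sup>2 * E\<^sup>2) * (norm v * W) + q i"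
      using elim(6) by (simp add: q_def \<rho>\<theta>_def)
    from mult_right_mono[OF this norm_ge_zero[of u]]
    have t1: "norm ((\<theta>1 i * \<beta> i - (v \<bullet> w i - \<theta> i)) *\<^sub>R u)
        \<le> ((c * E + 2 * c\<^sup>2 * E\<^sup>2) * (norm v * W) + q i) * norm u" by simp
    \<comment> \<open>Of the two copies of \<open>E * T\<close> in \<open>d1\<close>, one stays with
      the factor \<open>1 + cs\<close>; this bounds the other by a multiple of
      \<open>W\<close>.\<close>
    have "\<bar>\<theta> i\<bar> \<le> norm v * W + \<rho>\<theta> i"
      using Cauchy_Schwarz_ineq2[of v "w i"] by (simp add: \<rho>\<theta>_def)
    from mult_left_mono[OF mult_right_mono[OF this norm_ge_zero[of u]], of E] pos
    have T1: "E * T \<le> E * ((norm v * W + \<rho>\<theta> i) * norm u)" by simp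
    have "norm (b - M *v x i) \<le> norm (b - \<theta> i *\<^sub>R u - d i) + norm (d i - A *v w i)
        + norm (M *v (x i - (w i - p i))) + norm (M *v (p i - \<theta>1 i *\<^sub>R z i))
        + norm (\<theta>1 i *\<^sub>R (A *v z i - u)) + norm ((\<theta>1 i * (\<beta> i - (1 + v \<bullet> z i))) *\<^sub>R u)
        + norm ((\<theta>1 i * \<beta> i - (v \<bullet> w i - \<theta> i)) *\<^sub>R u)"
      unfolding M_def backward_error_residual_decomposition[of b A u v "x i" "\<theta> i" "d i" "w i" "p i"
          "\<theta>1 i" "z i" "\<beta> i"]
      by (intro norm_triangle_le norm_triangle_le_diff add_mono order_refl)
    also have "\<dots> \<le> (E * B + E * (2 + E) * T) + cs * E * (mat_norm2 A * W + (B + T + \<rho>d i))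
        + N * (E * (W + P)) + N * \<rho>p i + \<bar>\<theta>1 i\<bar> * \<rho>z i + \<bar>\<theta>1 i\<bar> * \<rho>\<beta> i * norm u
        + ((c * E + 2 * c\<^sup>2 * E\<^sup>2) * (norm v * W) + q i) * norm u"
      using d1 solve x1 p1 t1
      by (intro add_mono) (simp_all add: \<rho>d_def \<rho>z_def \<rho>\<beta>_def abs_mult norm_minus_commute)
    \<comment> \<open>All first-order multiples of \<open>W\<close> are collected. The summand of
      \<open>g\<close> with \<open>\<rho>x\<close> is held back for the passage from
      \<open>W\<close> to \<open>X\<close>, while \<open>N * (E * P)\<close> is already second order
      and goes into \<open>g\<close>.\<close>
    also have "\<dots> \<le> E * (1 + cs) * (T + B)
        + E * (W * (norm u * norm v + cs * mat_norm2 A + N + c * (norm u * norm v)))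
        + (g i - E * (\<rho>x i * ((2 + cs + c) * N)))"
      using T1 by (simp add: g_def T_def algebra_simps power2_eq_square del: T_def[symmetric])
    also have "W * (norm u * norm v + cs * mat_norm2 A + N + c * (norm u * norm v))
        \<le> (X + \<rho>x i) * (N + cs * N + N + c * N)"
    proof (rule mult_mono)
      show "W \<le> X + \<rho>x i" using norm_triangle_sub[of "w i" "x i"] by (simp add: \<rho>x_def)
      show "norm u * norm v + cs * mat_norm2 A + N + c * (norm u * norm v) \<le> N + cs * N + N + c * N"
        using N0 c0 cs_nonneg by (intro add_mono mult_left_mono) auto
    qed (use pos mat_norm2_nonneg[of A] N0 c0 cs_nonneg in \<open>auto simp: \<rho>x_def\<close>)
    also have "E * (1 + cs) * (T + B) + E * ((X + \<rho>x i) * (N + cs * N + N + c * N))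
        + (g i - E * (\<rho>x i * ((2 + cs + c) * N)))
        = E * ((2 + cs + c) * (N * X)) + E * (1 + cs) * (T + B) + g i"
      by (simp add: algebra_simps)
    also have "\<dots> \<le> E * ((2 * c + 4 + 2 * cs) * (N * (X + P)))
        + E * (1 + cs) * (norm u * (\<bar>\<theta> i\<bar> + \<bar>\<theta>1 i\<bar>) + B) + g i"
    proof -
      have "(2 + cs + c) * (N * X) \<le> (2 * c + 4 + 2 * cs) * (N * (X + P))"
        using pos N0 c0 cs_nonneg by (intro mult_mono mult_left_mono) auto
      moreover have "T + B \<le> norm u * (\<bar>\<theta> i\<bar> + \<bar>\<theta>1 i\<bar>) + B"
        unfolding T_def by (simp add: algebra_simps del: T_def[symmetric])
      ultimately show ?thesis
        using pos cs_nonneg by (intro add_mono mult_left_mono order_refl) auto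
    qed
    finally show ?case using pos by (simp add: M_def mult.assoc mult_left_mono)
  qed
qed

text \<open>Rounding errors are relative, so zeros propagate exactly through the whole run. The
  solves return 0 for a zero right-hand side because the perturbation of \<open>A\<close> is
  eventually too small to create a kernel.\<close>

lemma x_eq_0:
  assumes "b = 0"
  shows "\<forall>\<^sub>F i in F. x i = 0"
proof -
  obtain K where "\<forall>\<^sub>F i in F. \<forall>g s. stable_solve cs (e i) A g s \<longrightarrow> norm s \<le> K * norm g"
    using eventually_solve_norm_le by blast
  then show ?thesis using run
  proof eventually_elim
    case (elim i)
    have solve: "s = 0" if "stable_solve cs (e i) A 0 s" for s
      using elim(1) that by fastforce
    have inner: "s = 0" if "fl_inner (e i) v 0 s" for s
      using that by (auto simp: fl_inner_def)
    have rounded: "s = 0" if "fl_rounded (e i) 0 s" for s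
      using that by (simp add: fl_rounded_def)
    have rounded_vec: "s = 0" if "fl_rounded_vec (e i) 0 s" for s :: "real^'n"
      using that by (simp add: fl_rounded_vec_def rounded vec_eq_iff)
    note run = elim(2)[unfolded msm_run_def assms]
    have "y i = 0" using run solve by blast
    then have "\<alpha> i = 0" using run inner by metis
    then have \<theta>: "\<theta> i = 0" using run rounded by (metis div_0)
    then have "d i = 0" using run rounded_vec by (metis scaleR_zero_left diff_zero)
    then have w: "w i = 0" using run solve by metis
    then have "\<theta>1 i = 0" using run \<theta> rounded inner by (metis div_0 diff_zero)
    then have "p i = 0" using run rounded_vec by (metis scaleR_zero_left)
    then show ?case using run w rounded_vec by (metis diff_zero)
  qed
qed

lemma backward_error_bound:
  defines "D i \<equiv> mat_norm2 (A + outer_prod u v) * norm (x i) + norm b"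
  shows "\<exists>C. \<forall>\<^sub>F i in F. D i \<noteq> 0 \<longrightarrow> backward_error (A + outer_prod u v) b (x i)
    \<le> e i * (2 * real CARD('n) + 4 + 2 * cs)
        * ((mat_norm2 A + norm u * norm v) * (norm (x i) + norm (p i)) / D i)
      + e i * (1 + cs) * ((norm u * (\<bar>\<theta> i\<bar> + \<bar>\<theta>1 i\<bar>) + norm b) / D i)
      + C * (e i)\<^sup>2"
proof (cases "b = 0")
  case True
  \<comment> \<open>Here \<open>D i\<close> is eventually 0, so the implication is vacuous and any
    constant will do.\<close>
  show ?thesis
    using x_eq_0[OF True] by (intro exI[of _ 0]) (auto simp: D_def True elim!: eventually_mono)
next
  case False
  obtain g where g: "g \<in> O[F](\<lambda>i. (e i)\<^sup>2)"
    and bound: "\<forall>\<^sub>F i in F. norm (b - (A + outer_prod u v) *v x i) \<le>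
      e i * (2 * real CARD('n) + 4 + 2 * cs)
        * ((mat_norm2 A + norm u * norm v) * (norm (x i) + norm (p i)))
      + e i * (1 + cs) * (norm u * (\<bar>\<theta> i\<bar> + \<bar>\<theta>1 i\<bar>) + norm b) + g i"
    using residual_bound by blast
  obtain K where K: "0 < K" "\<forall>\<^sub>F i in F. norm (g i) \<le> K * norm ((e i)\<^sup>2)"
    using g by (rule landau_o.bigE)
  show ?thesis
  \<comment> \<open>\<open>D i\<close> varies with the run but is at least \<open>norm b\<close>,
    which makes the constant independent of the run.\<close>
  proof (rule exI[of _ "K / norm b"])
    show "\<forall>\<^sub>F i in F. D i \<noteq> 0 \<longrightarrow> backward_error (A + outer_prod u v) b (x i)
      \<le> e i * (2 * real CARD('n) + 4 + 2 * cs)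
          * ((mat_norm2 A + norm u * norm v) * (norm (x i) + norm (p i)) / D i)
        + e i * (1 + cs) * ((norm u * (\<bar>\<theta> i\<bar> + \<bar>\<theta>1 i\<bar>) + norm b) / D i)
        + K / norm b * (e i)\<^sup>2"
      using bound K(2)
    proof eventually_elim
      case (elim i)
      have "norm b \<le> D i" "0 < norm b"
        using False by (auto simp: D_def mat_norm2_nonneg intro!: mult_nonneg_nonneg)
      then have D: "norm b \<le> D i" "0 < norm b" "0 < D i" by linarith+
      have "g i / D i \<le> K * (e i)\<^sup>2 / D i"
        using elim(2) D by (intro divide_right_mono) auto
      also have "\<dots> \<le> K * (e i)\<^sup>2 / norm b"
        using D K(1) by (intro divide_left_mono) auto
      finally have "g i / D i \<le> K / norm b * (e i)\<^sup>2" by simp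
      moreover have "backward_error (A + outer_prod u v) b (x i) = norm (b - (A + outer_prod u v) *v x i) / D i"
        by (simp add: backward_error_def D_def)
      moreover have "norm (b - (A + outer_prod u v) *v x i) / D i \<le> (e i * (2 * real CARD('n) + 4 + 2 * cs)
        * ((mat_norm2 A + norm u * norm v) * (norm (x i) + norm (p i)))
        + e i * (1 + cs) * (norm u * (\<bar>\<theta> i\<bar> + \<bar>\<theta>1 i\<bar>) + norm b) + g i) / D i"
        using elim(1) D by (intro divide_right_mono) auto
      moreover have "(r * X + s * Y + h) / t = r * (X / t) + s * (Y / t) + h / t" for r s t h X Y :: real
        by (simp add: add_divide_distrib)
      ultimately show ?case by simp
    qed
  qed
qed

end

section \<open>From families of runs to a bound uniform over all runs\<close>

lemma stable_solve_const_nonneg: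
  fixes A :: "real^'n^'n"
  assumes "invertible A" and "stable_solve cs eps A g s" and "0 < eps"
  shows "0 \<le> cs"
proof -
  have "mat_norm2 A \<noteq> 0"
  proof
    assume 0: "mat_norm2 A = 0"
    obtain k where "\<And>x. norm x \<le> k * norm (A *v x)"
      using invertible_bounded_below[OF assms(1)] by metis
    from this[of 1] norm_matrix_vector_le[of A 1] 0 have "norm (1 :: real^'n) \<le> 0" by simp
    then show False by simp
  qed
  then have "0 < eps * mat_norm2 A" using mat_norm2_nonneg[of A] assms(3) by simp
  \<comment> \<open>The norm of the perturbation of \<open>A\<close> lies below this
    product.\<close>
  moreover have "0 \<le> cs * (eps * mat_norm2 A)"
    using assms(2) mat_norm2_nonneg unfolding stable_solve_def by (metis mult.assoc order_trans)
  ultimately show ?thesis by (simp add: zero_le_mult_iff)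
qed

theorem theorem4p2:
  fixes A :: "real^'n^'n" and u v b :: "real^'n" and cs :: real
  assumes "invertible A"
    and "invertible (A + outer_prod u v)"
  shows "\<exists>C. \<forall>\<^sub>F eps in at_right 0.
    \<forall>y z \<alpha> \<beta> \<theta> d w \<theta>1 p x.
      real CARD('n) * eps < 1 \<longrightarrow>
      msm_run cs eps A u v b y z \<alpha> \<beta> \<theta> d w \<theta>1 p x \<longrightarrow>
      \<beta> \<noteq> 0 \<longrightarrow>
      mat_norm2 (A + outer_prod u v) * norm x + norm b \<noteq> 0 \<longrightarrow>
      backward_error (A + outer_prod u v) b x
        \<le> eps * (2 * real CARD('n) + 4 + 2 * cs)
            * ((mat_norm2 A + norm u * norm v) * (norm x + norm p)
                / (mat_norm2 (A + outer_prod u v) * norm x + norm b))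
          + eps * (1 + cs)
            * ((norm u * (\<bar>\<theta>\<bar> + \<bar>\<theta>1\<bar>) + norm b)
                / (mat_norm2 (A + outer_prod u v) * norm x + norm b))
          + C * eps\<^sup>2"
proof (cases "0 \<le> cs")
  case False
  \<comment> \<open>For negative \<open>cs\<close> there is no run at all, so the bound holds
    vacuously.\<close>
  have "\<not> msm_run cs eps A u v b y z \<alpha> \<beta> \<theta> d w \<theta>1 p x"
    if "0 < eps" for eps y z \<alpha> \<beta> \<theta> d w \<theta>1 p x
    using stable_solve_const_nonneg[OF assms(1) _ that] False by (auto simp: msm_run_def)
  then show ?thesis
    by (intro exI[of _ 0] eventually_mono[OF eventually_at_right_less[of 0]]) blast
next
  case True
  define R where "R = {(eps, y, z, \<alpha>, \<beta>, \<theta>, d, w, \<theta>1, p, x).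
    msm_run cs eps A u v b y z \<alpha> \<beta> \<theta> d w \<theta>1 p x \<and> \<beta> \<noteq> 0}"
  \<comment> \<open>An index is a tuple of \<open>eps\<close> and a complete run with that
    \<open>eps\<close>. Eventually along this filter means for all small positive \<open>eps\<close>
    and all their runs with nonzero \<open>\<beta>\<close>, so a constant found for the family is
    uniform in the rounding errors.\<close>
  define F where "F = inf (filtercomap fst (at_right 0)) (principal R)"
  have F: "eventually P F \<longleftrightarrow> (\<forall>\<^sub>F eps in at_right 0. \<forall>r. (eps, r) \<in> R \<longrightarrow> P (eps, r))" for P
    unfolding F_def eventually_inf_principal eventually_filtercomap
    by (auto elim: eventually_mono)
  interpret msm_family F "\<lambda>(eps, y, z, \<alpha>, \<beta>, \<theta>, d, w, \<theta>1, p, x). eps" A u v b cs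
    "\<lambda>(eps, y, z, \<alpha>, \<beta>, \<theta>, d, w, \<theta>1, p, x). y"
    "\<lambda>(eps, y, z, \<alpha>, \<beta>, \<theta>, d, w, \<theta>1, p, x). z"
    "\<lambda>(eps, y, z, \<alpha>, \<beta>, \<theta>, d, w, \<theta>1, p, x). d"
    "\<lambda>(eps, y, z, \<alpha>, \<beta>, \<theta>, d, w, \<theta>1, p, x). w"
    "\<lambda>(eps, y, z, \<alpha>, \<beta>, \<theta>, d, w, \<theta>1, p, x). p"
    "\<lambda>(eps, y, z, \<alpha>, \<beta>, \<theta>, d, w, \<theta>1, p, x). x"
    "\<lambda>(eps, y, z, \<alpha>, \<beta>, \<theta>, d, w, \<theta>1, p, x). \<alpha>"
    "\<lambda>(eps, y, z, \<alpha>, \<beta>, \<theta>, d, w, \<theta>1, p, x). \<beta>"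
    "\<lambda>(eps, y, z, \<alpha>, \<beta>, \<theta>, d, w, \<theta>1, p, x). \<theta>"
    "\<lambda>(eps, y, z, \<alpha>, \<beta>, \<theta>, d, w, \<theta>1, p, x). \<theta>1"
  proof
    have "filterlim fst (at_right 0) F"
      unfolding F_def by (rule filterlim_mono[OF filterlim_filtercomap order_refl inf_le1])
    then have "(fst \<longlongrightarrow> 0) F" using at_within_le_nhds filterlim_mono by blast
    then show "((\<lambda>(eps, y, z, \<alpha>, \<beta>, \<theta>, d, w, \<theta>1, p, x). eps) \<longlongrightarrow> 0) F"
      by (simp add: case_prod_unfold)
    show "\<forall>\<^sub>F r in F. 0 < (case r of (eps, y, z, \<alpha>, \<beta>, \<theta>, d, w, \<theta>1, p, x) \<Rightarrow> eps)"
      unfolding F by (rule eventually_mono[OF eventually_at_right_less]) auto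
  qed (auto simp: F R_def True assms)
  show ?thesis
    using backward_error_bound unfolding F
    by (elim exE, intro exI) (erule eventually_mono, fastforce simp: R_def)
qed

end
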